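(* (i) For every integer $d\ge 2$, $\lambda(d,1)\ge \left(1-2^{-d}\right)^{2^d-1}$. (ii) For all integers $d\ge 1$ and $0\le s\le 2^d$, $\lambda(d,s)\ge c_d$. (iii) Let $d\ge 1$ and let $s$ be an integer with $0<s\le 2^{d-1}$, written as $s=2^k\cdot j$ with $k\ge 0$ an integer and $j$ an odd integer. Then $\lambda(d,s)\ge c(d,k)$. (iv) In particular, for every $d\ge 1$ and every $s\le 2^d$ which is a power of $2$, $\lambda(d,s)\ge 1-\frac1s$.
   Context: $Q_n$ is the hypercube of dimension $n$, with vertex set $\{0,1\}^n$. For $d\le n$, a $d$-cube (copy of $Q_d$) in $Q_n$ is a set of vertices obtained by fixing the values of some $n-d$ coordinates and letting the other $d$ coordinates range over all $2^d$ binary vectors; there are $2^{n-d}\binom{n}{d}$ of them. For a subset $A$ of vertices of $Q_n$, $\lambda(n,d,s,A)$ is the fraction of all $d$-cubes in $Q_n$ that contain exactly $s$ vertices of $A$. $\lambda(n,d,s)$ is the maximum of $\lambda(n,d,s,A)$ over all subsets $A$ of vertices of $Q_n$. For fixed $d,s$, $\lambda(n,d,s)$ is non-increasing in $n$, and $\lambda(d,s)=\lim_{n\to\infty}\lambda(n,d,s)=\inf_{n\ge d}\lambda(n,d,s)$. $c_d$ denotes the probability that a random $d\times d$ binary matrix whose rows are independent uniformly random nonzero vectors of $\mathbb{F}_2^d$ is nonsingular over $\mathbb{F}_2$; explicitly $c_d=\prod_{i=1}^{d-1}\left(1-\frac{2^i-1}{2^d-1}\right)$. For $0\le k\le d$,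 $c(d,k)$ denotes the probability that a random $(d-k)\times d$ binary matrix whose columns are independent uniformly random vectors of $\mathbb{F}_2^{d-k}$ has rank $d-k$ over $\mathbb{F}_2$; explicitly $c(d,k)=\prod_{i=0}^{d-k-1}\left(1-\frac{2^i}{2^d}\right)$. *)

theory Defs
  imports
    "HOL-Probability.Probability"
    "HOL-Library.Z2"
    "Jordan_Normal_Form.DL_Rank"
begin

unbundle no vec_syntax
notation Matrix.vec_index (infixl "$" 100)

definition hypercube :: "nat \<Rightarrow> bit vec set" where
  "hypercube n = carrier_vec n"

text \<open>The copy of \<open>Q\<^sub>d\<close> with set of free coordinates \<open>J\<close>, the remaining coordinates being fixed to
  their values in \<open>x\<close>.\<close>

definition face :: "nat \<Rightarrow> nat set \<Rightarrow> bit vec \<Rightarrow> bit vec set" where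
  "face n J x = {y \<in> hypercube n. \<forall>i<n. i \<notin> J \<longrightarrow> y $ i = x $ i}"

definition subcubes :: "nat \<Rightarrow> nat \<Rightarrow> bit vec set set" where
  "subcubes n d = {face n J x | J x. J \<subseteq> {..<n} \<and> card J = d \<and> x \<in> hypercube n}"

definition lambda_set :: "nat \<Rightarrow> nat \<Rightarrow> nat \<Rightarrow> bit vec set \<Rightarrow> real" where
  "lambda_set n d s A =
     real (card {C \<in> subcubes n d. card (C \<inter> A) = s}) / real (card (subcubes n d))"

definition lambda_max :: "nat \<Rightarrow> nat \<Rightarrow> nat \<Rightarrow> real" where
  "lambda_max n d s = Max (lambda_set n d s ` Pow (hypercube n))"

text \<open>The values of \<open>lambda_max n d s\<close> for \<open>n < d\<close> are meaningless but do not affect the limit.\<close>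

definition lambda :: "nat \<Rightarrow> nat \<Rightarrow> real" where
  "lambda d s = lim (\<lambda>n. lambda_max n d s)"

text \<open>In the next two definitions \<open>r i\<close> and \<open>r j\<close> are the independent random rows and columns,
  respectively; \<open>0\<^sub>v\<close> is only the irrelevant default value of the product distribution outside the
  index set. The first definition is meaningful for \<open>d \<ge> 1\<close> only, as otherwise there is no nonzero
  vector.\<close>

definition c_nonsing :: "nat \<Rightarrow> real" where
  "c_nonsing d =
     measure_pmf.prob
       (Pi_pmf {..<d} (0\<^sub>v d) (\<lambda>i. pmf_of_set (carrier_vec d - {0\<^sub>v d :: bit vec})))
       {r. Determinant.det (mat_of_rows d (map r [0..<d])) \<noteq> 0}"

definition c_rank :: "nat \<Rightarrow> nat \<Rightarrow> real" where
  "c_rank d k =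
     measure_pmf.prob
       (Pi_pmf {..<d} (0\<^sub>v (d - k)) (\<lambda>j. pmf_of_set (carrier_vec (d - k) :: bit vec set)))
       {r. vec_space.rank (d - k) (mat_of_cols (d - k) (map r [0..<d])) = d - k}"

end

theory Submission
  imports Defs
begin

text \<open>The limit defining \<open>\<lambda>(d,s)\<close> is bounded below by \<open>c\<close> as soon as, for every \<open>n \<ge> d\<close>, there is a
  random vertex set that meets every fixed \<open>d\<close>-cube in exactly \<open>s\<close> vertices with probability at least
  \<open>c\<close>. For (i) the set contains each vertex independently with probability \<open>2\<^sup>-\<^sup>d\<close>. For (ii) and (iii) it
  is the preimage of a fixed set under a random linear map to \<open>F\<^sub>2\<^sup>m\<close>, whose restriction to a \<open>d\<close>-cube is
  onto with probability \<open>c\<^sub>d\<close> (for \<open>m = d\<close> and nonzero columns) or \<open>c(d,k)\<close> (for \<open>m = d - k\<close>). For (iv), a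
  map that is not onto has a nontrivial row relation, and a union bound over these gives \<open>2\<^sup>m / 2\<^sup>d\<close>.\<close>

subsection \<open>Faces of the hypercube\<close>

lemma carrier_vec_eqI:
  assumes "x \<in> carrier_vec n" "y \<in> carrier_vec n" "\<And>i. i < n \<Longrightarrow> x $ i = y $ i"
  shows "x = y"
  using assms by (intro eq_vecI) auto

lemma card_carrier_vec_bit:
  "card (carrier_vec n :: bit vec set) = 2 ^ n" and finite_carrier_vec_bit: "finite (carrier_vec n :: bit vec set)"
proof -
  let ?f = "\<lambda>S. vec n (\<lambda>i. of_bool (i \<in> S) :: bit)"
  have *: "bij_betw ?f (Pow {..<n}) (carrier_vec n)"
    by (rule bij_betw_byWitness[where f' = "\<lambda>x. {i. i < n \<and> x $ i = 1}"]) (auto intro!: carrier_vec_eqI)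
  show "card (carrier_vec n :: bit vec set) = 2 ^ n"
    using bij_betw_same_card[OF *] by (simp add: card_Pow)
  show "finite (carrier_vec n :: bit vec set)"
    using bij_betw_finite[OF *] by simp
qed

lemma card_hypercube [simp]: "card (hypercube n) = 2 ^ n"
  and finite_hypercube [simp]: "finite (hypercube n)"
  by (simp_all add: hypercube_def card_carrier_vec_bit finite_carrier_vec_bit)

lemma face_subset: "face n J x \<subseteq> hypercube n"
  by (auto simp: face_def)

lemma finite_face [simp]: "finite (face n J x)"
  using finite_subset[OF face_subset] by simp

text \<open>The enumeration \<open>h\<close> of the free coordinates identifies a
  \<open>d\<close>-cube with \<open>carrier_vec d\<close>. This gives its size and later lets a
  linear map be read in these local coordinates.\<close>

lemma bij_betw_face:
  assumes h: "bij_betw h {..<d} J" and J: "J \<subseteq> {..<n}"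
  shows "bij_betw (\<lambda>y. vec n (\<lambda>i. if i \<in> J then y $ inv_into {..<d} h i else x $ i))
    (carrier_vec d) (face n J x)"
proof (rule bij_betw_byWitness[where f' = "\<lambda>z. vec d (\<lambda>l. z $ h l)"])
  have hJ: "h l \<in> J" "h l < n" if "l < d" for l
    using h J that by (auto simp: bij_betw_def)
  have inv: "inv_into {..<d} h (h l) = l" if "l < d" for l
    using h that by (auto simp: bij_betw_def inv_into_f_f)
  have inv': "inv_into {..<d} h i < d" "h (inv_into {..<d} h i) = i" if "i \<in> J" for i
    using h that inv_into_into[of i h "{..<d}"] by (auto simp: bij_betw_def f_inv_into_f)
  show "\<forall>y\<in>carrier_vec d. vec d (\<lambda>l. vec n (\<lambda>i. if i \<in> J then y $ inv_into {..<d} h i else x $ i) $ h l) = y"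
    by (auto intro!: carrier_vec_eqI simp: hJ inv)
  show "\<forall>z\<in>face n J x. vec n (\<lambda>i. if i \<in> J then vec d (\<lambda>l. z $ h l) $ inv_into {..<d} h i else x $ i) = z"
    by (auto intro!: carrier_vec_eqI simp: face_def hypercube_def inv')
  show "(\<lambda>y. vec n (\<lambda>i. if i \<in> J then y $ inv_into {..<d} h i else x $ i)) ` carrier_vec d \<subseteq> face n J x"
    by (auto simp: face_def hypercube_def)
qed auto

lemma card_face:
  assumes "J \<subseteq> {..<n}"
  shows "card (face n J x) = 2 ^ card J"
proof -
  have "finite J" using assms finite_subset by blast
  then obtain h where "bij_betw h {..<card J} J"
    using ex_bij_betw_nat_finite[of J] by (auto simp: atLeast0LessThan)
  from bij_betw_same_card[OF bij_betw_face[OF this assms, of x]] show ?thesis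
    by (simp add: card_carrier_vec_bit)
qed

lemma mem_face_self: "x \<in> hypercube n \<Longrightarrow> x \<in> face n J x"
  by (simp add: face_def)

lemma face_eq: "z \<in> face n J x \<Longrightarrow> face n J z = face n J x"
  by (auto simp: face_def)

text \<open>The free coordinates are exactly those that are not constant on the cube, so the cube
  determines \<open>J\<close> although it does not determine its base point.\<close>

lemma face_dirs:
  assumes J: "J \<subseteq> {..<n}" "x \<in> hypercube n"
  shows "J = {i. i < n \<and> (\<exists>y\<in>face n J x. \<exists>z\<in>face n J x. y $ i \<noteq> z $ i)}"
proof (intro equalityI subsetI)
  fix i assume i: "i \<in> J"
  \<comment> \<open>Flip coordinate \<open>i\<close> of \<open>x\<close>: over \<open>bit\<close>,
    adding 1 always changes the value.\<close>
  let ?y = "vec n (\<lambda>j. if j = i then x $ i + 1 else x $ j)"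
  have "?y \<in> face n J x" "?y $ i \<noteq> x $ i"
    using i J by (auto simp: face_def hypercube_def subset_iff)
  then show "i \<in> {i. i < n \<and> (\<exists>y\<in>face n J x. \<exists>z\<in>face n J x. y $ i \<noteq> z $ i)}"
    using i J mem_face_self by blast
qed (auto simp: face_def, metis)

lemma face_inject:
  assumes "J \<subseteq> {..<n}" "x \<in> hypercube n" "J' \<subseteq> {..<n}" "x' \<in> hypercube n"
    and "face n J x = face n J' x'"
  shows "J = J'"
  using face_dirs[of J n x] face_dirs[of J' n x'] assms by simp

text \<open>A \<open>d\<close>-cube arises from exactly \<open>2 ^ d\<close> pairs
  \<open>(J, x)\<close>, because \<open>J\<close> is forced and each of its vertices can serve as
  base point. Sums over cubes thus become sums over a product set.\<close>

lemma sum_subcubes: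
  fixes g :: "bit vec set \<Rightarrow> real"
  shows "(\<Sum>J | J \<subseteq> {..<n} \<and> card J = d. \<Sum>x\<in>hypercube n. g (face n J x)) =
    2 ^ d * (\<Sum>C\<in>subcubes n d. g C)"
proof -
  let ?P = "{J. J \<subseteq> {..<n} \<and> card J = d} \<times> hypercube n"
  have fin: "finite {J. J \<subseteq> {..<n} \<and> card J = d}" by simp
  have img: "subcubes n d = (\<lambda>(J, x). face n J x) ` ?P"
    by (auto simp: subcubes_def)
  have "(\<Sum>J | J \<subseteq> {..<n} \<and> card J = d. \<Sum>x\<in>hypercube n. g (face n J x)) = (\<Sum>(J, x)\<in>?P. g (face n J x))"
    by (simp add: sum.cartesian_product)
  also have "\<dots> = (\<Sum>C\<in>subcubes n d. \<Sum>(J, x)\<in>{p\<in>?P. (\<lambda>(J, x). face n J x) p = C}. g (face n J x))"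
    unfolding img using fin by (intro sum.image_gen) auto
  also have "\<dots> = (\<Sum>C\<in>subcubes n d. 2 ^ d * g C)"
  proof (rule sum.cong[OF refl])
    fix C assume "C \<in> subcubes n d"
    then obtain J x where J: "J \<subseteq> {..<n}" "card J = d" "x \<in> hypercube n" and C: "C = face n J x"
      by (auto simp: subcubes_def)
    have "{p\<in>?P. (\<lambda>(J, x). face n J x) p = C} = {J} \<times> C"
    proof (intro equalityI subsetI)
      fix p assume "p \<in> {p\<in>?P. (\<lambda>(J, x). face n J x) p = C}"
      then obtain J' x' where p: "p = (J', x')" "J' \<subseteq> {..<n}" "x' \<in> hypercube n" "face n J' x' = C"
        by auto
      then show "p \<in> {J} \<times> C"
        using face_inject[of J' n x' J x] J C mem_face_self[of x' n J'] by auto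
    next
      fix p assume "p \<in> {J} \<times> C"
      then show "p \<in> {p\<in>?P. (\<lambda>(J, x). face n J x) p = C}"
        using J C face_subset[of n J x] face_eq[of _ n J x] by auto
    qed
    moreover have "(\<Sum>(J, x)\<in>{J} \<times> C. g (face n J x)) = (\<Sum>x\<in>C. g (face n J x))"
      by (simp add: sum.cartesian_product[symmetric])
    moreover have "\<dots> = (\<Sum>x\<in>C. g C)"
      using C face_eq by (intro sum.cong) auto
    ultimately show "(\<Sum>(J, x)\<in>{p\<in>?P. (\<lambda>(J, x). face n J x) p = C}. g (face n J x)) = 2 ^ d * g C"
      using card_face[OF J(1), of x] C J(2) by simp
  qed
  finally show ?thesis by (simp add: sum_distrib_left)
qed

lemma finite_subcubes [simp]: "finite (subcubes n d)"
  by (rule finite_subset[of _ "Pow (hypercube n)"]) (auto simp: subcubes_def face_def)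

text \<open>Taking the constant weight 1 in \<open>sum_subcubes\<close> counts the pairs. The
  product form avoids the truncated difference \<open>n - d\<close> and also holds for
  \<open>n < d\<close>, where both sides vanish.\<close>

lemma card_subcubes: "2 ^ d * real (card (subcubes n d)) = real (n choose d) * 2 ^ n"
  using sum_subcubes[where g = "\<lambda>_. 1" and n = n and d = d] n_subsets[of "{..<n}" d] by simp

lemma card_subcubes_pos: "d \<le> n \<Longrightarrow> card (subcubes n d) > 0"
  using card_subcubes[of d n] by (auto intro!: Nat.gr0I)

section \<open>Densities and the first-moment method\<close>

lemma lambda_set_eq_sum:
  "lambda_set n d s A = (\<Sum>C\<in>subcubes n d. of_bool (card (C \<inter> A) = s)) / real (card (subcubes n d))"
  by (simp add: lambda_set_def of_bool_def sum.If_cases Int_def)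

lemma lambda_set_eq_face_sum:
  "lambda_set n d s A = (\<Sum>J | J \<subseteq> {..<n} \<and> card J = d. \<Sum>x\<in>hypercube n.
     of_bool (card (face n J x \<inter> A) = s)) / (real (n choose d) * 2 ^ n)"
  unfolding lambda_set_eq_sum sum_subcubes[where g = "\<lambda>C. of_bool (card (C \<inter> A) = s)"] card_subcubes[symmetric]
  by simp

lemma lambda_set_le_max: "A \<subseteq> hypercube n \<Longrightarrow> lambda_set n d s A \<le> lambda_max n d s"
  unfolding lambda_max_def by (intro Max_ge) auto

lemma lambda_max_attained:
  obtains A where "A \<subseteq> hypercube n" "lambda_max n d s = lambda_set n d s A"
proof -
  have "lambda_max n d s \<in> lambda_set n d s ` Pow (hypercube n)"
    unfolding lambda_max_def by (intro Max_in) auto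
  then show thesis using that by auto
qed

text \<open>By linearity of expectation the expected number of cubes meeting the random set in
  \<open>s\<close> vertices is at least \<open>c\<close> times the number of cubes, whereas no
  outcome exceeds \<open>lambda_max n d s\<close> times that number.\<close>

lemma lambda_max_ge_prob:
  fixes p :: "'a pmf" and A :: "'a \<Rightarrow> bit vec set"
  assumes dn: "d \<le> n" and A: "\<And>\<omega>. A \<omega> \<subseteq> hypercube n"
    and c: "\<And>C. C \<in> subcubes n d \<Longrightarrow> c \<le> measure_pmf.prob p {\<omega>. card (C \<inter> A \<omega>) = s}"
  shows "c \<le> lambda_max n d s"
proof -
  \<comment> \<open>The distribution \<open>p\<close> may have infinite support, so integrability is
    derived from boundedness.\<close>
  have int: "integrable (measure_pmf p) (\<lambda>\<omega>. of_bool (card (C \<inter> A \<omega>) = s) :: real)" for C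
    by (rule measure_pmf.integrable_const_bound[where B = 1]) auto
  have E: "measure_pmf.expectation p (\<lambda>\<omega>. of_bool (card (C \<inter> A \<omega>) = s))
      = measure_pmf.prob p {\<omega>. card (C \<inter> A \<omega>) = s}" for C
  proof -
    have "(\<lambda>\<omega>. of_bool (card (C \<inter> A \<omega>) = s) :: real) = indicator {\<omega>. card (C \<inter> A \<omega>) = s}"
      by (auto simp: indicator_def)
    then show ?thesis by simp
  qed
  have pos: "real (card (subcubes n d)) > 0" using card_subcubes_pos[OF dn] by simp
  have "c * card (subcubes n d) \<le> (\<Sum>C\<in>subcubes n d. measure_pmf.prob p {\<omega>. card (C \<inter> A \<omega>) = s})"
    using sum_mono[of "subcubes n d" "\<lambda>_. c", OF c] by (simp add: mult.commute)
  also have "\<dots> = measure_pmf.expectation p (\<lambda>\<omega>. \<Sum>C\<in>subcubes n d. of_bool (card (C \<inter> A \<omega>) = s))"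
    by (subst Bochner_Integration.integral_sum) (simp_all only: int E)
  also have "\<dots> \<le> measure_pmf.expectation p (\<lambda>\<omega>. lambda_max n d s * card (subcubes n d))"
  proof (rule integral_mono)
    fix \<omega>
    show "(\<Sum>C\<in>subcubes n d. of_bool (card (C \<inter> A \<omega>) = s)) \<le> lambda_max n d s * card (subcubes n d)"
      using lambda_set_le_max[OF A, of d s \<omega>] pos unfolding lambda_set_eq_sum by (simp add: divide_simps)
  qed (rule Bochner_Integration.integrable_sum, rule int, simp)
  finally show ?thesis using pos by simp
qed

subsection \<open>Monotonicity in the dimension\<close>

text \<open>Glue a bijection from \<open>J\<close> to \<open>J'\<close> with one between the
  complements, which also have equal size.\<close>

lemma ex_permutes_image:
  assumes S: "finite S" and J: "J \<subseteq> S" "J' \<subseteq> S" "card J = card J'"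
  obtains \<tau> where "\<tau> permutes S" "\<tau> ` J = J'"
proof -
  have fin: "finite J" "finite J'" using S J finite_subset by auto
  obtain f where f: "bij_betw f J J'"
    using finite_same_card_bij[OF fin J(3)] by auto
  have "card (S - J) = card (S - J')" using S J fin by (simp add: card_Diff_subset)
  then obtain g where g: "bij_betw g (S - J) (S - J')"
    using finite_same_card_bij[of "S - J" "S - J'"] S by auto
  define \<tau> where "\<tau> x = (if x \<in> J then f x else if x \<in> S then g x else x)" for x
  have fJ: "bij_betw \<tau> J J'"
    using f by (rule bij_betw_cong[THEN iffD1, rotated]) (simp add: \<tau>_def)
  have "bij_betw \<tau> (S - J) (S - J')"
    using g by (rule bij_betw_cong[THEN iffD1, rotated]) (simp add: \<tau>_def)
  with fJ have "bij_betw \<tau> (J \<union> (S - J)) (J' \<union> (S - J'))"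
    by (rule bij_betw_combine) auto
  moreover have "J \<union> (S - J) = S" "J' \<union> (S - J') = S" using J by auto
  ultimately have "\<tau> permutes S" using J by (intro bij_imp_permutes) (auto simp: \<tau>_def)
  with fJ show thesis by (intro that) (auto simp: bij_betw_def)
qed

lemma bij_betw_image_subsets:
  assumes "\<sigma> permutes S"
  shows "bij_betw (\<lambda>J. \<sigma> ` J) {J. J \<subseteq> S \<and> card J = d} {J. J \<subseteq> S \<and> card J = d}"
proof (rule bij_betw_byWitness[where f' = "\<lambda>J. inv_into UNIV \<sigma> ` J"])
  have *: "(\<lambda>J. \<tau> ` J) ` {J. J \<subseteq> S \<and> card J = d} \<subseteq> {J. J \<subseteq> S \<and> card J = d}" if "\<tau> permutes S" for \<tau>
    using that permutes_image[OF that] permutes_inj[OF that]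
    by (auto simp: card_image inj_on_subset permutes_in_image)
  show "(\<lambda>J. \<sigma> ` J) ` {J. J \<subseteq> S \<and> card J = d} \<subseteq> {J. J \<subseteq> S \<and> card J = d}"
    and "(\<lambda>J. inv_into UNIV \<sigma> ` J) ` {J. J \<subseteq> S \<and> card J = d} \<subseteq> {J. J \<subseteq> S \<and> card J = d}"
    using * assms permutes_inv by auto
qed (use permutes_inverses[OF assms] in \<open>auto simp: image_comp\<close>)

text \<open>A uniformly random permutation carries \<open>J\<close> to a uniformly random set of the
  same size. The proof sums over all candidates \<open>J'\<close> as well and evaluates the double
  sum in both orders.\<close>

lemma sum_permutes_image:
  fixes G :: "'a set \<Rightarrow> real"
  assumes S: "finite S" and J: "J \<subseteq> S"
  shows "real (card S choose card J) * (\<Sum>\<sigma> | \<sigma> permutes S. G (\<sigma> ` J)) =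
    fact (card S) * (\<Sum>J' | J' \<subseteq> S \<and> card J' = card J. G J')"
proof -
  let ?K = "{J'. J' \<subseteq> S \<and> card J' = card J}"
  have indep: "(\<Sum>\<sigma> | \<sigma> permutes S. G (\<sigma> ` J')) = (\<Sum>\<sigma> | \<sigma> permutes S. G (\<sigma> ` J))" if "J' \<in> ?K" for J'
  proof -
    have "J' \<subseteq> S" "card J = card J'" using that by auto
    then obtain \<tau> where \<tau>: "\<tau> permutes S" "\<tau> ` J = J'"
      by (rule ex_permutes_image[OF S J])
    then show ?thesis
      \<comment> \<open>Replacing \<open>\<sigma>\<close> by its composite with
        \<open>\<tau>\<close> only reorders the permutations and turns the image of \<open>J\<close>
        into the image of \<open>J'\<close>.\<close>
      by (subst (2) sum_permutations_compose_right[OF \<tau>(1)]) (simp add: \<tau>(2)[symmetric] image_image)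
  qed
  have "real (card S choose card J) * (\<Sum>\<sigma> | \<sigma> permutes S. G (\<sigma> ` J)) =
      (\<Sum>J'\<in>?K. \<Sum>\<sigma> | \<sigma> permutes S. G (\<sigma> ` J'))"
    using S by (simp add: indep n_subsets)
  also have "\<dots> = (\<Sum>\<sigma> | \<sigma> permutes S. \<Sum>J'\<in>?K. G (\<sigma> ` J'))"
    by (rule sum.swap)
  also have "\<dots> = (\<Sum>\<sigma> | \<sigma> permutes S. \<Sum>J'\<in>?K. G J')"
    using bij_betw_image_subsets by (intro sum.cong refl sum.reindex_bij_betw) auto
  also have "\<dots> = fact (card S) * (\<Sum>J'\<in>?K. G J')"
    using S by (simp add: card_permutations)
  finally show ?thesis .
qed

text \<open>Coordinate \<open>i\<close> goes to position \<open>\<sigma> i\<close>, and the result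
  is translated by \<open>z\<close>. A random \<open>\<sigma>\<close> randomizes the directions of a
  cube, a random \<open>z\<close> its base point.\<close>

definition cube_embed :: "nat \<Rightarrow> nat \<Rightarrow> (nat \<Rightarrow> nat) \<Rightarrow> bit vec \<Rightarrow> bit vec \<Rightarrow> bit vec" where
  "cube_embed n N \<sigma> z x = z + vec N (\<lambda>j. if inv_into UNIV \<sigma> j < n then x $ inv_into UNIV \<sigma> j else 0)"

lemma cube_embed_in: "z \<in> hypercube N \<Longrightarrow> cube_embed n N \<sigma> z x \<in> hypercube N"
  by (auto simp: cube_embed_def hypercube_def)

lemma cube_embed_index:
  "j < N \<Longrightarrow> cube_embed n N \<sigma> z x $ j = z $ j + (if inv_into UNIV \<sigma> j < n then x $ inv_into UNIV \<sigma> j else 0)"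
  by (simp add: cube_embed_def)

lemma bij_betw_cube_embed_face:
  assumes \<sigma>: "\<sigma> permutes {..<N}" and z: "z \<in> hypercube N" and nN: "n \<le> N"
    and J: "J \<subseteq> {..<n}" and x: "x \<in> hypercube n"
  shows "bij_betw (cube_embed n N \<sigma> z) (face n J x) (face N (\<sigma> ` J) (cube_embed n N \<sigma> z x))"
proof (rule bij_betw_byWitness[where f' = "\<lambda>w. vec n (\<lambda>i. w $ \<sigma> i - z $ \<sigma> i)"])
  have \<sigma>N: "\<sigma> i < N" if "i < n" for i
    using permutes_in_image[OF \<sigma>, of i] that nN by auto
  have invs [simp]: "inv_into UNIV \<sigma> (\<sigma> i) = i" "\<sigma> (inv_into UNIV \<sigma> i) = i" for i
    using permutes_inverses[OF \<sigma>] by auto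
  have mem: "j \<in> \<sigma> ` J \<longleftrightarrow> inv_into UNIV \<sigma> j \<in> J" for j
    by (metis image_iff invs)
  show "\<forall>y\<in>face n J x. vec n (\<lambda>i. cube_embed n N \<sigma> z y $ \<sigma> i - z $ \<sigma> i) = y"
    by (auto intro!: carrier_vec_eqI simp: face_def hypercube_def cube_embed_index \<sigma>N)
  show "cube_embed n N \<sigma> z ` face n J x \<subseteq> face N (\<sigma> ` J) (cube_embed n N \<sigma> z x)"
    using cube_embed_in[OF z] by (auto simp: face_def cube_embed_index mem)
  show "\<forall>w\<in>face N (\<sigma> ` J) (cube_embed n N \<sigma> z x). cube_embed n N \<sigma> z (vec n (\<lambda>i. w $ \<sigma> i - z $ \<sigma> i)) = w"
  proof
    fix w assume w: "w \<in> face N (\<sigma> ` J) (cube_embed n N \<sigma> z x)"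
    show "cube_embed n N \<sigma> z (vec n (\<lambda>i. w $ \<sigma> i - z $ \<sigma> i)) = w"
    proof (rule carrier_vec_eqI)
      fix j assume j: "j < N"
      \<comment> \<open>Positions that do not come from the small cube are fixed on the image face,
        since \<open>J\<close> lies in \<open>{..<n}\<close>; there the embedding shows only
        \<open>z\<close>.\<close>
      have "w $ j = z $ j" if "\<not> inv_into UNIV \<sigma> j < n"
      proof -
        have "j \<notin> \<sigma> ` J" using that J mem by auto
        then show ?thesis using w j that by (simp add: face_def cube_embed_index)
      qed
      then show "cube_embed n N \<sigma> z (vec n (\<lambda>i. w $ \<sigma> i - z $ \<sigma> i)) $ j = w $ j"
        using j by (simp add: cube_embed_index)
    qed (use w cube_embed_in[OF z] in \<open>auto simp: face_def hypercube_def\<close>)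
  qed
  show "(\<lambda>w. vec n (\<lambda>i. w $ \<sigma> i - z $ \<sigma> i)) ` face N (\<sigma> ` J) (cube_embed n N \<sigma> z x) \<subseteq> face n J x"
  proof
    fix y assume "y \<in> (\<lambda>w. vec n (\<lambda>i. w $ \<sigma> i - z $ \<sigma> i)) ` face N (\<sigma> ` J) (cube_embed n N \<sigma> z x)"
    then obtain w where w: "w \<in> face N (\<sigma> ` J) (cube_embed n N \<sigma> z x)"
      and y: "y = vec n (\<lambda>i. w $ \<sigma> i - z $ \<sigma> i)" by auto
    have "w $ \<sigma> i - z $ \<sigma> i = x $ i" if "i < n" "i \<notin> J" for i
    proof -
      have "w $ \<sigma> i = z $ \<sigma> i + x $ i"
        using w that \<sigma>N[OF that(1)] mem[of "\<sigma> i"] by (simp add: face_def cube_embed_index del: add_bit_eq_xor)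
      then show ?thesis by (metis add_diff_cancel_left')
    qed
    then show "y \<in> face n J x" by (auto simp: face_def hypercube_def y)
  qed
qed

lemma bij_betw_translate:
  assumes "w \<in> carrier_vec n"
  shows "bij_betw (\<lambda>z. z + w) (hypercube n) (hypercube n)"
  using assms
  by (intro bij_betw_byWitness[where f' = "\<lambda>z. z - w"]) (auto intro!: carrier_vec_eqI simp: hypercube_def)

text \<open>An optimal set of the larger cube is pulled back along a random embedding of the smaller cube,
  under which every fixed \<open>d\<close>-cube becomes a uniformly distributed one.\<close>

lemma lambda_max_antimono:
  assumes dn: "d \<le> n" and nN: "n \<le> N"
  shows "lambda_max N d s \<le> lambda_max n d s"
proof -
  obtain A where A: "A \<subseteq> hypercube N" "lambda_max N d s = lambda_set N d s A"
    by (rule lambda_max_attained)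
  let ?\<Sigma> = "{\<sigma>. \<sigma> permutes {..<N}}"
  let ?\<Omega> = "?\<Sigma> \<times> hypercube N"
  \<comment> \<open>Uniformity on the product makes \<open>\<sigma>\<close> and \<open>z\<close>
    independent and uniform.\<close>
  let ?p = "pmf_of_set ?\<Omega>"
  let ?B = "\<lambda>(\<sigma>, z). {x \<in> hypercube n. cube_embed n N \<sigma> z x \<in> A}"
  have fin: "finite ?\<Omega>" by (simp add: finite_permutations)
  have ne: "?\<Omega> \<noteq> {}"
    using permutes_id[of "{..<N}"] zero_carrier_vec[of N] unfolding hypercube_def by blast
  have card: "card ?\<Omega> = fact N * 2 ^ N"
    by (simp add: card_cartesian_product card_permutations)
  have "lambda_set N d s A \<le> lambda_max n d s"
  proof (rule lambda_max_ge_prob[OF dn, where p = ?p and A = ?B])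
    show "?B \<omega> \<subseteq> hypercube n" for \<omega> by (auto split: prod.split)
  next
    fix C assume "C \<in> subcubes n d"
    then obtain J x where J: "J \<subseteq> {..<n}" "card J = d" and x: "x \<in> hypercube n" and C: "C = face n J x"
      by (auto simp: subcubes_def)
    have JN: "J \<subseteq> {..<N}" using J nN by auto
    have card_eq: "card (C \<inter> ?B (\<sigma>, z)) = card (face N (\<sigma> ` J) (cube_embed n N \<sigma> z x) \<inter> A)"
      if "(\<sigma>, z) \<in> ?\<Omega>" for \<sigma> z
    proof -
      have b: "bij_betw (cube_embed n N \<sigma> z) C (face N (\<sigma> ` J) (cube_embed n N \<sigma> z x))"
        unfolding C using that by (intro bij_betw_cube_embed_face nN J x) auto
      have sub: "C \<inter> ?B (\<sigma>, z) = {y \<in> C. cube_embed n N \<sigma> z y \<in> A}"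
        using face_subset[of n J x] by (auto simp: C)
      from b have "bij_betw (cube_embed n N \<sigma> z) (C \<inter> ?B (\<sigma>, z))
          (face N (\<sigma> ` J) (cube_embed n N \<sigma> z x) \<inter> A)"
        unfolding sub by (auto simp: bij_betw_def intro: inj_on_subset)
      then show ?thesis by (rule bij_betw_same_card)
    qed
    let ?g = "\<lambda>J y. of_bool (card (face N J y \<inter> A) = s) :: real"
    have "real (card (?\<Omega> \<inter> {\<omega>. card (C \<inter> ?B \<omega>) = s})) =
        (\<Sum>\<omega>\<in>?\<Omega>. of_bool (card (C \<inter> ?B \<omega>) = s))"
      using fin by (simp add: of_bool_def sum.If_cases)
    also have "\<dots> = (\<Sum>(\<sigma>, z)\<in>?\<Omega>. ?g (\<sigma> ` J) (cube_embed n N \<sigma> z x))"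
      by (rule sum.cong[OF refl]) (use card_eq in \<open>auto simp del: Int_iff\<close>)
    also have "\<dots> = (\<Sum>\<sigma>\<in>?\<Sigma>. \<Sum>z\<in>hypercube N. ?g (\<sigma> ` J) (cube_embed n N \<sigma> z x))"
      by (simp only: sum.cartesian_product)
    \<comment> \<open>For fixed \<open>\<sigma>\<close>, the image of \<open>x\<close> is a
      translate of \<open>z\<close> by a fixed vector and hence runs once through the whole cube;
      the dependence on \<open>x\<close> disappears.\<close>
    also have "\<dots> = (\<Sum>\<sigma>\<in>?\<Sigma>. \<Sum>y\<in>hypercube N. ?g (\<sigma> ` J) y)"
      unfolding cube_embed_def by (intro sum.cong refl sum.reindex_bij_betw bij_betw_translate) auto
    finally have "real (N choose d) * real (card (?\<Omega> \<inter> {\<omega>. card (C \<inter> ?B \<omega>) = s})) =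
        fact N * (\<Sum>J | J \<subseteq> {..<N} \<and> card J = d. \<Sum>y\<in>hypercube N. ?g J y)"
      using sum_permutes_image[OF _ JN, of "\<lambda>J. \<Sum>y\<in>hypercube N. ?g J y"] J(2)
      by simp
    moreover have "real (N choose d) > 0" using dn nN by simp
    \<comment> \<open>Every \<open>C\<close> is thus hit with probability equal to the density of
      \<open>A\<close>.\<close>
    ultimately have "real (card (?\<Omega> \<inter> {\<omega>. card (C \<inter> ?B \<omega>) = s})) / card ?\<Omega> = lambda_set N d s A"
      unfolding lambda_set_eq_face_sum card by (simp add: field_simps)
    then show "lambda_set N d s A \<le> measure_pmf.prob ?p {\<omega>. card (C \<inter> ?B \<omega>) = s}"
      by (simp only: measure_pmf_of_set[OF ne fin])
  qed
  with A show ?thesis by simp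
qed

lemma lambda_max_nonneg: "0 \<le> lambda_max n d s"
proof -
  obtain A where "lambda_max n d s = lambda_set n d s A" by (rule lambda_max_attained)
  then show ?thesis by (simp add: lambda_set_def)
qed

text \<open>Monotonicity holds from \<open>n = d\<close> on, so convergence is shown for the
  sequence shifted by \<open>d\<close>. Only then does \<open>lim\<close> denote an actual limit,
  which inherits the bound.\<close>

lemma lambda_ge:
  assumes "\<And>n. n \<ge> d \<Longrightarrow> c \<le> lambda_max n d s"
  shows "c \<le> lambda d s"
proof -
  have "decseq (\<lambda>n. lambda_max (n + d) d s)"
    by (auto simp: decseq_def intro: lambda_max_antimono)
  moreover have "Bseq (\<lambda>n. lambda_max (n + d) d s)"
    using lambda_max_nonneg lambda_max_antimono[of d d]
    by (intro BseqI'[where K = "lambda_max d d s"]) simp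
  ultimately have "convergent (\<lambda>n. lambda_max (n + d) d s)"
    by (intro Bseq_monoseq_convergent) (auto simp: monoseq_iff)
  then have "convergent (\<lambda>n. lambda_max n d s)"
    unfolding convergent_def by (blast intro: LIMSEQ_offset)
  then have "(\<lambda>n. lambda_max n d s) \<longlonglongrightarrow> lambda d s"
    by (simp add: lambda_def convergent_LIMSEQ_iff)
  then show ?thesis using assms by (intro LIMSEQ_le_const) auto
qed

subsection \<open>Random vertex sets\<close>

lemma lambda_ge_random_subset:
  "lambda d 1 \<ge> (1 - 1 / 2 ^ d) ^ (2 ^ d - 1)"
proof (rule lambda_ge)
  fix n assume dn: "n \<ge> d"
  \<comment> \<open>With this density the expected number of chosen vertices in a
    \<open>d\<close>-cube is 1.\<close>
  define q :: real where "q = 1 / 2 ^ d"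
  have q: "0 \<le> q" "q \<le> 1" "2 ^ d * q = 1" by (auto simp: q_def)
  show "(1 - 1 / 2 ^ d) ^ (2 ^ d - 1) \<le> lambda_max n d 1"
  proof (rule lambda_max_ge_prob[OF dn, where p = "Pi_pmf (hypercube n) False (\<lambda>_. bernoulli_pmf q)"
        and A = "\<lambda>f. {x \<in> hypercube n. f x}"])
    fix C assume "C \<in> subcubes n d"
    then have C: "C \<subseteq> hypercube n" "card C = 2 ^ d" "finite C"
      using face_subset by (auto simp: subcubes_def card_face)
    have "measure_pmf.prob (Pi_pmf (hypercube n) False (\<lambda>_. bernoulli_pmf q))
          {f. card (C \<inter> {x \<in> hypercube n. f x}) = 1} =
        measure_pmf.prob (map_pmf (\<lambda>f. card {x\<in>C. f x})
          (map_pmf (\<lambda>f x. if x \<in> C then f x else False) (Pi_pmf (hypercube n) False (\<lambda>_. bernoulli_pmf q)))) {1}"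
    proof -
      have "C \<inter> {x \<in> hypercube n. f x} = {x \<in> C. if x \<in> C then f x else False}" for f
        using C(1) by auto
      then show ?thesis by (simp add: vimage_def)
    qed
    \<comment> \<open>Restricted to \<open>C\<close>, the choices are still independent, so their
      number is binomial with \<open>2 ^ d\<close> trials.\<close>
    also have "\<dots> = pmf (binomial_pmf (2 ^ d) q) 1"
      using C q by (simp only: Pi_pmf_subset[OF finite_hypercube C(1), symmetric])
        (subst binomial_pmf_altdef'[OF C(3,2), of q False], auto simp: measure_pmf_single)
    \<comment> \<open>The factor \<open>2 ^ d * q\<close> of the binomial probability at 1 equals
      1.\<close>
    also have "\<dots> = (1 - q) ^ (2 ^ d - 1)"
      using q by simp
    finally show "(1 - 1 / 2 ^ d) ^ (2 ^ d - 1) \<le> measure_pmf.prob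
        (Pi_pmf (hypercube n) False (\<lambda>_. bernoulli_pmf q)) {f. card (C \<inter> {x \<in> hypercube n. f x}) = 1}"
      by (simp add: q_def)
  qed auto
qed

section \<open>Linear maps restricted to cubes and their fibres\<close>

abbreviation onto_mat :: "nat \<Rightarrow> nat \<Rightarrow> bit mat \<Rightarrow> bool" where
  "onto_mat m d M \<equiv> (\<lambda>y. M *\<^sub>v y) ` carrier_vec d = carrier_vec m"

text \<open>Each fibre is a translate of the kernel by some preimage \<open>u\<close> of
  \<open>w\<close>, so \<open>2 ^ m\<close> equally large fibres partition \<open>2 ^ d\<close>
  vectors.\<close>

lemma card_fibre:
  assumes M: "M \<in> carrier_mat m d" and onto: "onto_mat m d M" and md: "m \<le> d" and w: "w \<in> carrier_vec m"
  shows "card {y \<in> carrier_vec d. M *\<^sub>v y = w} = 2 ^ (d - m)"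
proof -
  let ?F = "\<lambda>w. {y \<in> carrier_vec d. M *\<^sub>v y = w}"
  have eq: "card (?F w) = card (?F (0\<^sub>v m))" if w: "w \<in> carrier_vec m" for w
  proof -
    from w onto have "w \<in> (\<lambda>y. M *\<^sub>v y) ` carrier_vec d" by simp
    then obtain u where u: "u \<in> carrier_vec d" "M *\<^sub>v u = w" by auto
    have "bij_betw (\<lambda>y. y + u) (?F (0\<^sub>v m)) (?F w)"
    proof (rule bij_betw_byWitness[where f' = "\<lambda>y. y - u"])
      have add: "M *\<^sub>v (y + u) = w" if "y \<in> carrier_vec d" "M *\<^sub>v y = 0\<^sub>v m" for y
        unfolding mult_add_distrib_mat_vec[OF M that(1) u(1)] that(2) u(2) using w by simp
      show "(\<lambda>y. y + u) ` ?F (0\<^sub>v m) \<subseteq> ?F w"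
        by (rule image_subsetI) (use add add_carrier_vec[OF _ u(1)] in blast)
      have diff: "M *\<^sub>v (y - u) = 0\<^sub>v m" if "y \<in> carrier_vec d" "M *\<^sub>v y = w" for y
        unfolding mult_minus_distrib_mat_vec[OF M that(1) u(1)] that(2) u(2) using w by simp
      show "(\<lambda>y. y - u) ` ?F w \<subseteq> ?F (0\<^sub>v m)"
        by (rule image_subsetI) (use diff minus_carrier_vec[OF _ u(1)] in blast)
      show "\<forall>y\<in>?F (0\<^sub>v m). y + u - u = y" "\<forall>y\<in>?F w. y - u + u = y"
        using u(1) by (auto intro!: eq_vecI)
    qed
    then show ?thesis by (simp add: bij_betw_same_card)
  qed
  have "carrier_vec d = (\<Union>w\<in>carrier_vec m. ?F w)"
    using mult_mat_vec_carrier[OF M] by blast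
  then have "card (carrier_vec d :: bit vec set) = card (\<Union>w\<in>carrier_vec m. ?F w)"
    by (rule arg_cong)
  also have "\<dots> = (\<Sum>w\<in>carrier_vec m. card (?F w))"
    by (rule card_UN_disjoint) (auto simp: finite_carrier_vec_bit)
  also have "\<dots> = (\<Sum>w\<in>(carrier_vec m :: bit vec set). card (?F (0\<^sub>v m)))"
    by (intro sum.cong refl eq)
  also have "\<dots> = 2 ^ m * card (?F (0\<^sub>v m))"
    by (simp add: card_carrier_vec_bit)
  finally have "2 ^ m * card (?F (0\<^sub>v m)) = 2 ^ m * 2 ^ (d - m)"
    using md by (simp add: card_carrier_vec_bit flip: power_add)
  then show ?thesis using eq[OF w] by simp
qed

lemma add_vec_eq_iff:
  fixes a c w :: "'a :: ab_group_add vec"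
  assumes "a \<in> carrier_vec m" "c \<in> carrier_vec m" "w \<in> carrier_vec m"
  shows "c + a = w \<longleftrightarrow> a = w - c"
  using assms by (auto simp: vec_eq_iff eq_diff_eq add.commute)

lemma card_preimage:
  assumes M: "M \<in> carrier_mat m d" and onto: "onto_mat m d M" and md: "m \<le> d"
    and c: "c \<in> carrier_vec m" and S: "S \<subseteq> carrier_vec m"
  shows "card {y \<in> carrier_vec d. c + M *\<^sub>v y \<in> S} = 2 ^ (d - m) * card S"
proof -
  let ?F = "\<lambda>w. {y \<in> carrier_vec d. M *\<^sub>v y = w - c}"
  have iff: "c + M *\<^sub>v y = w \<longleftrightarrow> M *\<^sub>v y = w - c" if "y \<in> carrier_vec d" "w \<in> carrier_vec m" for y w
    by (rule add_vec_eq_iff) (use mult_mat_vec_carrier[OF M that(1)] that(2) c in blast)+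
  have "c + M *\<^sub>v y \<in> S \<longleftrightarrow> (\<exists>w\<in>S. M *\<^sub>v y = w - c)" if y: "y \<in> carrier_vec d" for y
    using iff[OF y] S by blast
  then have "{y \<in> carrier_vec d. c + M *\<^sub>v y \<in> S} = (\<Union>w\<in>S. ?F w)"
    by blast
  also have "card \<dots> = (\<Sum>w\<in>S. card (?F w))"
  proof (rule card_UN_disjoint)
    show "finite S" using S finite_carrier_vec_bit finite_subset by blast
    show "\<forall>w\<in>S. finite (?F w)" by (simp add: finite_carrier_vec_bit)
    show "\<forall>w\<in>S. \<forall>w'\<in>S. w \<noteq> w' \<longrightarrow> ?F w \<inter> ?F w' = {}"
    proof (intro ballI impI equals0I)
      fix w w' y assume w: "w \<in> S" "w' \<in> S" "w \<noteq> w'" and "y \<in> ?F w \<inter> ?F w'"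
      then have "y \<in> carrier_vec d" "M *\<^sub>v y = w - c" "M *\<^sub>v y = w' - c" by blast+
      with iff[of y w] iff[of y w'] w(1,2) S have "w = c + M *\<^sub>v y" "w' = c + M *\<^sub>v y" by blast+
      then show False using w(3) by blast
    qed
  qed
  also have "\<dots> = (\<Sum>w\<in>S. 2 ^ (d - m))"
    using S c by (intro sum.cong refl card_fibre[OF M onto md]) auto
  finally show ?thesis by simp
qed

text \<open>The fixed coordinates contribute a constant, and the free ones, renumbered by
  \<open>h\<close>, a linear map with columns \<open>v (h l)\<close>. On a \<open>d\<close>-cube the
  map is therefore affine in the local coordinates \<open>y\<close>.\<close>

lemma mat_of_cols_mult_face:
  fixes v :: "nat \<Rightarrow> bit vec"
  assumes h: "bij_betw h {..<d} J" and J: "J \<subseteq> {..<n}" and y: "y \<in> carrier_vec d"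
  shows "mat_of_cols m (map v [0..<n]) *\<^sub>v vec n (\<lambda>i. if i \<in> J then y $ inv_into {..<d} h i else x $ i) =
    mat_of_cols m (map v [0..<n]) *\<^sub>v vec n (\<lambda>i. if i \<in> J then 0 else x $ i) +
    mat_of_cols m (map (v \<circ> h) [0..<d]) *\<^sub>v y" (is "_ *\<^sub>v ?y = _ *\<^sub>v ?x + _")
proof (rule carrier_vec_eqI[of _ m])
  fix a assume a: "a < m"
  let ?h' = "inv_into {..<d} h"
  have idx: "(mat_of_cols m (map u [0..<l]) *\<^sub>v z) $ a = (\<Sum>i<l. u i $ a * z $ i)"
    if "z \<in> carrier_vec l" for u :: "nat \<Rightarrow> bit vec" and l and z :: "bit vec"
    using a that by (auto simp: scalar_prod_def mat_of_cols_def atLeast0LessThan intro!: sum.cong)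
  have "(\<Sum>i<n. v i $ a * ?y $ i) =
      (\<Sum>i<n. v i $ a * ?x $ i) + (\<Sum>i<n. if i \<in> J then v i $ a * y $ ?h' i else 0)"
    by (subst sum.distrib[symmetric]) (intro sum.cong refl, auto)
  also have "(\<Sum>i<n. if i \<in> J then v i $ a * y $ ?h' i else 0) = (\<Sum>i\<in>J. v i $ a * y $ ?h' i)"
    using J by (subst sum.inter_restrict[symmetric]) (auto simp: Int_absorb1)
  also have "\<dots> = (\<Sum>l<d. v (h l) $ a * y $ l)"
    using h by (subst sum.reindex_bij_betw[OF h, symmetric])
      (auto intro!: sum.cong simp: bij_betw_def inv_into_f_f)
  finally show "(mat_of_cols m (map v [0..<n]) *\<^sub>v ?y) $ a =
      (mat_of_cols m (map v [0..<n]) *\<^sub>v ?x + mat_of_cols m (map (v \<circ> h) [0..<d]) *\<^sub>v y) $ a"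
    using a y by (simp only: index_add_vec idx vec_carrier o_def dim_mult_mat_vec mat_of_cols_carrier)
qed (auto intro: carrier_vecI)

text \<open>Selecting and renumbering \<open>d\<close> members of an independent, identically
  distributed family yields a family of the same kind.\<close>

lemma prob_Pi_pmf_reindex:
  fixes h :: "nat \<Rightarrow> nat"
  assumes h: "bij_betw h {..<d} J" and J: "J \<subseteq> {..<n}"
  shows "measure_pmf.prob (Pi_pmf {..<n} dflt (\<lambda>_. D)) {v. P (map (v \<circ> h) [0..<d])} =
    measure_pmf.prob (Pi_pmf {..<d} dflt (\<lambda>_. D)) {r. P (map r [0..<d])}"
proof -
  \<comment> \<open>\<open>Pi_pmf_bij_betw\<close> wants indices outside \<open>{..<d}\<close> to
    land outside \<open>J\<close>. Nothing is known of \<open>h\<close> there, but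
    \<open>l + n\<close> exceeds every element of \<open>J\<close>.\<close>
  define k where "k l = (if l < d then h l else l + n)" for l
  have k: "bij_betw k {..<d} J"
    using h by (rule bij_betw_cong[THEN iffD1, rotated]) (simp add: k_def)
  have "Pi_pmf {..<d} dflt (\<lambda>_. D) = map_pmf (\<lambda>g. g \<circ> k) (Pi_pmf J dflt (\<lambda>_. D))"
    using J by (intro Pi_pmf_bij_betw k) (auto simp: k_def)
  also have "\<dots> = map_pmf (\<lambda>g. g \<circ> k) (map_pmf (\<lambda>f x. if x \<in> J then f x else dflt)
      (Pi_pmf {..<n} dflt (\<lambda>_. D)))"
    using J by (subst Pi_pmf_subset[of "{..<n}" J]) auto
  finally have *: "Pi_pmf {..<d} dflt (\<lambda>_. D) = \<dots>" .
  have eq: "map ((\<lambda>x. if x \<in> J then f x else dflt) \<circ> k) [0..<d] = map (f \<circ> h) [0..<d]" for f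
    using h by (auto simp: k_def bij_betw_def)
  show ?thesis
    unfolding * by (simp only: measure_map_pmf vimage_def mem_Collect_eq eq)
qed

text \<open>A random linear map \<open>x \<mapsto> \<Sum> x\<^sub>i v\<^sub>i\<close> restricted to a \<open>d\<close>-cube is, up to translation, given by \<open>d\<close> of
  the vectors \<open>v\<^sub>i\<close>. When these span the target, all fibres in the cube have equal size, so the preimage
  of any \<open>j\<close> points meets the cube in \<open>2 ^ (d - m) * j\<close> vertices.\<close>

lemma lambda_ge_prob_onto:
  fixes D :: "bit vec pmf"
  assumes md: "m \<le> d" and j: "j \<le> 2 ^ m"
  shows "lambda d (2 ^ (d - m) * j) \<ge> measure_pmf.prob (Pi_pmf {..<d} dflt (\<lambda>_. D))
    {r. onto_mat m d (mat_of_cols m (map r [0..<d]))}"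
proof (rule lambda_ge)
  fix n assume dn: "n \<ge> d"
  obtain S :: "bit vec set" where S: "S \<subseteq> carrier_vec m" "card S = j"
    using j obtain_subset_with_card_n[of j "carrier_vec m :: bit vec set"] by (auto simp: card_carrier_vec_bit)
  let ?A = "\<lambda>v. {x \<in> hypercube n. mat_of_cols m (map v [0..<n]) *\<^sub>v x \<in> S}"
  show "measure_pmf.prob (Pi_pmf {..<d} dflt (\<lambda>_. D)) {r. onto_mat m d (mat_of_cols m (map r [0..<d]))}
    \<le> lambda_max n d (2 ^ (d - m) * j)"
  proof (rule lambda_max_ge_prob[OF dn, where p = "Pi_pmf {..<n} dflt (\<lambda>_. D)" and A = ?A])
    fix C assume "C \<in> subcubes n d"
    then obtain J x where J: "J \<subseteq> {..<n}" "card J = d" and x: "x \<in> hypercube n" and C: "C = face n J x"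
      by (auto simp: subcubes_def)
    have "finite J" using J(1) finite_subset by blast
    then obtain h where h: "bij_betw h {..<d} J"
      using ex_bij_betw_nat_finite[of J] J(2) by (auto simp: atLeast0LessThan)
    let ?e = "\<lambda>y. vec n (\<lambda>i. if i \<in> J then y $ inv_into {..<d} h i else x $ i)"
    have "card (C \<inter> ?A v) = 2 ^ (d - m) * j" if onto: "onto_mat m d (mat_of_cols m (map (v \<circ> h) [0..<d]))" for v
    proof -
      \<comment> \<open>The translation part: the contribution of the coordinates that are fixed on
        \<open>C\<close>.\<close>
      let ?c = "mat_of_cols m (map v [0..<n]) *\<^sub>v vec n (\<lambda>i. if i \<in> J then 0 else x $ i)"
      let ?Y = "{y \<in> carrier_vec d. ?c + mat_of_cols m (map (v \<circ> h) [0..<d]) *\<^sub>v y \<in> S}"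
      have b: "bij_betw ?e (carrier_vec d) C"
        unfolding C by (rule bij_betw_face[OF h J(1)])
      have img: "?e ` ?Y = C \<inter> ?A v"
      proof -
        have "?e ` ?Y = {z \<in> ?e ` carrier_vec d. mat_of_cols m (map v [0..<n]) *\<^sub>v z \<in> S}"
          using mat_of_cols_mult_face[OF h J(1), of _ m v x] by auto
        also have "\<dots> = C \<inter> ?A v"
          using b face_subset[of n J x] by (auto simp: bij_betw_def C)
        finally show ?thesis .
      qed
      have "inj_on ?e ?Y"
        by (rule inj_on_subset[OF bij_betw_imp_inj_on[OF b]]) simp
      from bij_betw_same_card[OF bij_betw_imageI[OF this img]] have "card (C \<inter> ?A v) = card ?Y"
        by (rule sym)
      also have "\<dots> = 2 ^ (d - m) * card S"
        by (rule card_preimage[OF _ onto md _ S(1)]) (auto intro: carrier_vecI carrier_matI)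
      finally show ?thesis using S(2) by simp
    qed
    then have "{v. onto_mat m d (mat_of_cols m (map (v \<circ> h) [0..<d]))} \<subseteq> {v. card (C \<inter> ?A v) = 2 ^ (d - m) * j}"
      by blast
    then have "measure_pmf.prob (Pi_pmf {..<n} dflt (\<lambda>_. D)) {v. onto_mat m d (mat_of_cols m (map (v \<circ> h) [0..<d]))}
        \<le> measure_pmf.prob (Pi_pmf {..<n} dflt (\<lambda>_. D)) {v. card (C \<inter> ?A v) = 2 ^ (d - m) * j}"
      by (intro measure_pmf.finite_measure_mono) auto
    \<comment> \<open>The event involves only the columns indexed by \<open>J\<close>, so its
      probability does not depend on \<open>n\<close> or on the cube.\<close>
    then show "measure_pmf.prob (Pi_pmf {..<d} dflt (\<lambda>_. D)) {r. onto_mat m d (mat_of_cols m (map r [0..<d]))}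
        \<le> measure_pmf.prob (Pi_pmf {..<n} dflt (\<lambda>_. D)) {v. card (C \<inter> ?A v) = 2 ^ (d - m) * j}"
      by (subst (asm) prob_Pi_pmf_reindex[OF h J(1), where P = "\<lambda>vs. onto_mat m d (mat_of_cols m vs)"])
  qed auto
qed

subsection \<open>Matrices over the field with two elements\<close>

lemma onto_mat_of_right_inverse:
  assumes "M \<in> carrier_mat m d" "N \<in> carrier_mat d m" "M * N = 1\<^sub>m m"
  shows "onto_mat m d M"
proof (intro equalityI subsetI)
  fix z :: "bit vec" assume z: "z \<in> carrier_vec m"
  have "M *\<^sub>v (N *\<^sub>v z) = z"
    using assms z by (simp flip: assoc_mult_mat_vec)
  moreover have "N *\<^sub>v z \<in> carrier_vec d" using assms z by simp
  ultimately show "z \<in> (\<lambda>y. M *\<^sub>v y) ` carrier_vec d" by (metis imageI)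
qed (use assms in auto)

text \<open>\<open>c_nonsing\<close> takes the random vectors as rows and the linear map takes them
  as columns; the determinant is invariant under transposition.\<close>

lemma onto_mat_of_det:
  assumes r: "\<And>l. l < d \<Longrightarrow> r l \<in> carrier_vec d" and det: "det (mat_of_rows d (map r [0..<d])) \<noteq> 0"
  shows "onto_mat d d (mat_of_cols d (map r [0..<d]))"
proof -
  let ?M = "mat_of_cols d (map r [0..<d])"
  have M: "?M \<in> carrier_mat d d" by (auto intro: carrier_matI)
  have "transpose_mat ?M = mat_of_rows d (map r [0..<d])"
    by (rule eq_matI) (auto simp: mat_of_rows_def mat_of_cols_def)
  then have "det ?M \<noteq> 0" using det det_transpose[OF M] by simp
  from det_non_zero_imp_unit[OF M this, of undefined] obtain N where "N \<in> carrier_mat d d" "?M * N = 1\<^sub>m d"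
    by (auto simp: Units_def ring_mat_def)
  with M show ?thesis by (rule onto_mat_of_right_inverse)
qed

text \<open>The rank is the size of a maximal independent set of columns. Having \<open>m\<close>
  elements, such a set is a basis, so the column combinations fill the target.\<close>

lemma onto_mat_of_rank:
  assumes M: "M \<in> carrier_mat m d" and rank: "vec_space.rank m M = m"
  shows "onto_mat m d M"
proof -
  interpret vec_space "TYPE(bit)" m .
  have cols: "set (cols M) \<subseteq> carrier_vec m" using M cols_dim by blast
  have "lin_indpt {}" unfolding lin_dep_def by blast
  then obtain B where B: "finite B" "maximal B (\<lambda>T. T \<subseteq> set (cols M) \<and> lin_indpt T)"
    using maximal_exists_superset[of "set (cols M)" "\<lambda>T. T \<subseteq> set (cols M) \<and> lin_indpt T" "{}"]
    by blast
  have sub: "B \<subseteq> set (cols M)" "lin_indpt B" using B(2) by (auto simp: maximal_def)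
  have "card B = m" using rank_card_indpt[OF M B(2)] rank by simp
  then have "dim \<le> card B" by (simp only: dim_is_n)
  moreover have "B \<subseteq> carrier_vec m" using sub(1) cols by auto
  ultimately have "basis B" using dim_li_is_basis[OF fin_dim B(1) _ sub(2)] by blast
  then have "carrier_vec m = span B" unfolding basis_def by blast
  also have "\<dots> \<subseteq> span (set (cols M))" using sub(1) by (rule span_is_monotone)
  also have "\<dots> = span_list (cols M)" using cols by (rule span_list_as_span[symmetric])
  also have "\<dots> \<subseteq> (\<lambda>y. M *\<^sub>v y) ` carrier_vec d"
  proof
    fix z assume "z \<in> span_list (cols M)"
    then obtain c where "z = lincomb_list c (cols M)" unfolding span_list_def by blast
    also have "\<dots> = mat_of_cols m (cols M) *\<^sub>v vec (length (cols M)) c"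
      using cols by (intro lincomb_list_as_mat_mult) auto
    also have "\<dots> = M *\<^sub>v vec d c"
      using M mat_of_cols_cols[of M] by simp
    finally show "z \<in> (\<lambda>y. M *\<^sub>v y) ` carrier_vec d" by auto
  qed
  finally show ?thesis using M by auto
qed

text \<open>Row reduction either has a pivot in every row, and then yields a right inverse, or produces a
  vanishing row, which is a nontrivial relation between the rows of \<open>M\<close>.\<close>

lemma onto_mat_or_row_relation:
  assumes M: "M \<in> carrier_mat m d"
  obtains "onto_mat m d M"
  | w where "w \<in> carrier_vec m" "w \<noteq> 0\<^sub>v m" "\<And>l. l < d \<Longrightarrow> w \<bullet> col M l = 0"
proof -
  note gj = gauss_jordan_single[OF M refl]
  let ?C = "gauss_jordan_single M"
  obtain P Q where P: "?C = P * M" "P \<in> carrier_mat m m" "P * Q = 1\<^sub>m m" "Q \<in> carrier_mat m m" "Q * P = 1\<^sub>m m"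
    using gj(4) by auto
  have C: "?C \<in> carrier_mat m d" by (rule gj(2))
  obtain f where f: "pivot_fun ?C f d"
    using gj(3) C by (auto simp: row_echelon_form_def)
  have dim: "dim_row ?C = m" using C by simp
  show thesis
  \<comment> \<open>A pivot position equal to \<open>d\<close> encodes a zero row of the reduced
    matrix.\<close>
  proof (cases "\<exists>i<m. f i = d")
    case True
    then obtain i where i: "i < m" "f i = d" by auto
    have "row P i \<bullet> col M l = 0" if "l < d" for l
    proof -
      have "row P i \<bullet> col M l = ?C $$ (i, l)" using P(1,2) M i that by simp
      also have "\<dots> = 0" using pivot_funD(2)[OF dim f i(1)] i(2) that by simp
      finally show ?thesis .
    qed
    \<comment> \<open>A zero row in the invertible \<open>P\<close> would make a diagonal entry of
      \<open>P * Q\<close> vanish.\<close>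
    moreover have "row P i \<noteq> 0\<^sub>v m"
    proof
      assume "row P i = 0\<^sub>v m"
      moreover have "(P * Q) $$ (i, i) = row P i \<bullet> col Q i"
        using P(2,4) i(1) by (intro index_mult_mat) auto
      ultimately show False using P(3,4) i(1) by (simp add: col_carrier_vec)
    qed
    ultimately show thesis using P(2) i by (intro that(2)[of "row P i"]) auto
  next
    case False
    then have lt: "f i < d" if "i < m" for i
      using pivot_funD(1)[OF dim f that] that by force
    \<comment> \<open>Column \<open>i\<close> of \<open>R\<close> is the unit vector at the pivot
      \<open>f i\<close>, so \<open>?C * R\<close> extracts the pivot columns of \<open>?C\<close>,
      which are unit vectors.\<close>
    define R :: "bit mat" where "R = mat d m (\<lambda>(l, i). if f i = l then 1 else 0)"
    have R: "R \<in> carrier_mat d m" by (simp add: R_def)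
    have CR: "?C * R = 1\<^sub>m m"
    proof (rule eq_matI)
      fix i i' assume "i < dim_row (1\<^sub>m m :: bit mat)" "i' < dim_col (1\<^sub>m m :: bit mat)"
      then have i: "i < m" "i' < m" by auto
      have "(?C * R) $$ (i, i') = (\<Sum>l<d. ?C $$ (i, l) * (if f i' = l then 1 else 0))"
        using i C by (auto simp: R_def scalar_prod_def atLeast0LessThan intro!: sum.cong)
      also have "\<dots> = ?C $$ (i, f i')"
        using lt[OF i(2)] by (subst sum.remove[of _ "f i'"]) auto
      also have "\<dots> = 1\<^sub>m m $$ (i, i')"
        using pivot_funD(4,5)[OF dim f] lt i by auto
      finally show "(?C * R) $$ (i, i') = 1\<^sub>m m $$ (i, i')" .
    qed (use C R in auto)
    have "P * (M * R) = 1\<^sub>m m"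
      using CR P(1,2) M R by (simp add: assoc_mult_mat)
    \<comment> \<open>One-sided inverses of square matrices are two-sided, so \<open>R * P\<close>
      becomes a right inverse of \<open>M\<close>.\<close>
    then have "M * R * P = 1\<^sub>m m"
      using mat_mult_left_right_inverse[OF P(2), of "M * R"] M R by simp
    then have "M * (R * P) = 1\<^sub>m m"
      using M R P(2) by (simp add: assoc_mult_mat)
    then have "onto_mat m d M"
      using M R P(2) by (intro onto_mat_of_right_inverse[of M m d "R * P"]) auto
    then show thesis by (rule that(1))
  qed
qed

text \<open>Adding the unit vector at a position where \<open>w\<close> is 1 flips the scalar
  product with \<open>w\<close> and so exchanges its two level sets.\<close>

lemma card_orthogonal:
  fixes w :: "bit vec"
  assumes w: "w \<in> carrier_vec m" "w \<noteq> 0\<^sub>v m"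
  shows "2 * card {v \<in> carrier_vec m. w \<bullet> v = 0} = 2 ^ m"
proof -
  have "\<exists>i<m. w $ i \<noteq> 0"
    using w carrier_vec_eqI[OF w(1) zero_carrier_vec] by (metis index_zero_vec(1))
  then obtain i where i: "i < m" "w $ i = 1" by auto
  let ?O = "\<lambda>b. {v \<in> carrier_vec m. w \<bullet> v = (b :: bit)}"
  let ?u = "unit_vec m i :: bit vec"
  have u: "?u \<in> carrier_vec m" by simp
  have wu: "w \<bullet> ?u = 1" using w(1) i by (simp add: scalar_prod_right_unit)
  have "bij_betw (\<lambda>v. v + ?u) (?O 0) (?O 1)"
  proof (rule bij_betw_byWitness[where f' = "\<lambda>v. v - ?u"])
    have add: "w \<bullet> (v + ?u) = 1" if "v \<in> carrier_vec m" "w \<bullet> v = 0" for v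
      unfolding scalar_prod_add_distrib[OF w(1) that(1) u] that(2) wu by simp
    show "(\<lambda>v. v + ?u) ` ?O 0 \<subseteq> ?O 1"
      by (rule image_subsetI) (use add add_carrier_vec[OF _ u] in blast)
    have diff: "w \<bullet> (v - ?u) = 0" if "v \<in> carrier_vec m" "w \<bullet> v = 1" for v
      unfolding scalar_prod_minus_distrib[OF w(1) that(1) u] that(2) wu by simp
    show "(\<lambda>v. v - ?u) ` ?O 1 \<subseteq> ?O 0"
      by (rule image_subsetI) (use diff minus_carrier_vec[OF _ u] in blast)
  qed (auto intro!: eq_vecI)
  then have "card (?O 0) = card (?O 1)" by (rule bij_betw_same_card)
  moreover have "carrier_vec m = ?O 0 \<union> ?O 1" using bit_not_zero_iff by blast
  then have "card (carrier_vec m :: bit vec set) = card (?O 0) + card (?O 1)"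
    by (subst card_Un_disjoint[symmetric]) (auto simp: finite_carrier_vec_bit)
  ultimately show ?thesis by (simp add: card_carrier_vec_bit)
qed

lemma prob_onto_mat_ge:
  "measure_pmf.prob (Pi_pmf {..<d} dflt (\<lambda>_. pmf_of_set (carrier_vec m :: bit vec set)))
     {r. onto_mat m d (mat_of_cols m (map r [0..<d]))} \<ge> 1 - 2 ^ m / 2 ^ d"
proof -
  let ?V = "carrier_vec m :: bit vec set"
  let ?p = "Pi_pmf {..<d} dflt (\<lambda>_. pmf_of_set ?V)"
  let ?G = "{r. onto_mat m d (mat_of_cols m (map r [0..<d]))}"
  let ?W = "?V - {0\<^sub>v m}"
  let ?O = "\<lambda>w. {v \<in> ?V. w \<bullet> v = 0}"
  have ne: "?V \<noteq> {}" using zero_carrier_vec by blast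
  note fin = finite_carrier_vec_bit[of m]
  have half: "measure_pmf.prob (pmf_of_set ?V) (?O w) = 1 / 2" if "w \<in> ?W" for w
  proof -
    have "?V \<inter> ?O w = ?O w" by auto
    moreover have "2 * card (?O w) = 2 ^ m"
      using that by (intro card_orthogonal) auto
    then have "real (2 * card (?O w)) = real (2 ^ m)"
      by (rule arg_cong)
    then have "2 * real (card (?O w)) = 2 ^ m"
      by (simp only: of_nat_mult of_nat_numeral of_nat_power)
    ultimately show ?thesis
      unfolding measure_pmf_of_set[OF ne fin] card_carrier_vec_bit by (simp add: field_simps)
  qed
  \<comment> \<open>By independence, all \<open>d\<close> columns are orthogonal to a given nonzero
    \<open>w\<close> with probability \<open>(1 / 2) ^ d\<close>.\<close>
  have pw: "measure_pmf.prob ?p (PiE_dflt {..<d} dflt (\<lambda>_. ?O w)) = (1 / 2) ^ d" if "w \<in> ?W" for w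
    by (subst measure_Pi_pmf_PiE_dflt) (simp_all add: half[OF that])
  \<comment> \<open>Working on the support guarantees that the columns have dimension
    \<open>m\<close> and that \<open>r\<close> takes the default value elsewhere, as
    \<open>PiE_dflt\<close> demands.\<close>
  have sub: "set_pmf ?p - ?G \<subseteq> (\<Union>w\<in>?W. PiE_dflt {..<d} dflt (\<lambda>_. ?O w))"
  proof
    fix r assume r: "r \<in> set_pmf ?p - ?G"
    then have rV: "r \<in> PiE_dflt {..<d} dflt (\<lambda>_. ?V)"
      using set_Pi_pmf_subset[of "{..<d}" dflt "\<lambda>_. pmf_of_set ?V"]
      by (auto simp: set_Pi_pmf set_pmf_of_set[OF ne fin] PiE_dflt_def)
    let ?M = "mat_of_cols m (map r [0..<d])"
    have M: "?M \<in> carrier_mat m d" by (auto intro: carrier_matI)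
    have "\<not> onto_mat m d ?M" using r by simp
    then obtain w where w: "w \<in> ?V" "w \<noteq> 0\<^sub>v m" "\<And>l. l < d \<Longrightarrow> w \<bullet> col ?M l = 0"
      using onto_mat_or_row_relation[OF M] by metis
    have "w \<bullet> r l = 0" if "l < d" for l
      using w(3)[OF that] rV that by (auto simp: PiE_dflt_def)
    then have "r \<in> PiE_dflt {..<d} dflt (\<lambda>_. ?O w)" using rV by (auto simp: PiE_dflt_def)
    then show "r \<in> (\<Union>w\<in>?W. PiE_dflt {..<d} dflt (\<lambda>_. ?O w))" using w by auto
  qed
  have "1 - measure_pmf.prob ?p ?G = measure_pmf.prob ?p (- ?G)"
    by (simp add: measure_pmf.prob_compl[symmetric] Compl_eq_Diff_UNIV)
  also have "\<dots> = measure_pmf.prob ?p (- ?G \<inter> set_pmf ?p)"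
    by (rule measure_Int_set_pmf[symmetric])
  also have "\<dots> \<le> measure_pmf.prob ?p (\<Union>w\<in>?W. PiE_dflt {..<d} dflt (\<lambda>_. ?O w))"
    using sub by (intro measure_pmf.finite_measure_mono) auto
  also have "\<dots> \<le> (\<Sum>w\<in>?W. measure_pmf.prob ?p (PiE_dflt {..<d} dflt (\<lambda>_. ?O w)))"
    using fin by (intro measure_pmf.finite_measure_subadditive_finite) auto
  also have "\<dots> = (\<Sum>w\<in>?W. (1 / 2) ^ d)" by (intro sum.cong refl pw)
  \<comment> \<open>Admitting the zero vector rounds the count up to \<open>2 ^ m\<close>.\<close>
  also have "\<dots> \<le> (\<Sum>w\<in>?V. (1 / 2) ^ d)" using fin by (intro sum_mono2) auto
  also have "\<dots> = 2 ^ m / 2 ^ d" by (simp add: card_carrier_vec_bit power_divide)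
  finally show ?thesis by simp
qed

section \<open>Lower bounds from random linear maps\<close>

lemma lambda_ge_c_nonsing:
  assumes d: "d \<ge> 1" and s: "s \<le> 2 ^ d"
  shows "lambda d s \<ge> c_nonsing d"
proof -
  let ?V = "carrier_vec d - {0\<^sub>v d :: bit vec}"
  let ?p = "Pi_pmf {..<d} (0\<^sub>v d) (\<lambda>_. pmf_of_set ?V)"
  let ?det = "{r. det (mat_of_rows d (map r [0..<d])) \<noteq> 0}"
  let ?onto = "{r. onto_mat d d (mat_of_cols d (map r [0..<d]))}"
  have "unit_vec d 0 \<in> ?V" using d unit_vec_nonzero[of 0 d] by simp
  then have ne: "?V \<noteq> {}" by blast
  have fin: "finite ?V" by (simp add: finite_carrier_vec_bit)
  \<comment> \<open>On the support all vectors have dimension \<open>d\<close>, which the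
    determinant criterion requires.\<close>
  have "?det \<inter> set_pmf ?p \<subseteq> ?onto"
  proof
    fix r assume r: "r \<in> ?det \<inter> set_pmf ?p"
    then have "r l \<in> carrier_vec d" if "l < d" for l
      using that by (auto simp: set_Pi_pmf set_pmf_of_set[OF ne fin] PiE_dflt_def)
    then show "r \<in> ?onto" using onto_mat_of_det[of d r] r by blast
  qed
  then have "measure_pmf.prob ?p (?det \<inter> set_pmf ?p) \<le> measure_pmf.prob ?p ?onto"
    by (intro measure_pmf.finite_measure_mono) auto
  then have "c_nonsing d \<le> measure_pmf.prob ?p ?onto"
    by (simp only: c_nonsing_def measure_Int_set_pmf)
  \<comment> \<open>For \<open>m = d\<close> the fibres are single vertices, so any \<open>s\<close>
    up to \<open>2 ^ d\<close> occurs as \<open>j\<close>.\<close>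
  also have "\<dots> \<le> lambda d s"
    using lambda_ge_prob_onto[of d d s "0\<^sub>v d" "pmf_of_set ?V"] s by simp
  finally show ?thesis .
qed

text \<open>With a target of dimension \<open>d - k\<close>, every fibre in a \<open>d\<close>-cube
  has \<open>2 ^ k\<close> vertices, and \<open>j\<close> target points are chosen.\<close>

lemma lambda_ge_c_rank:
  assumes k: "k \<le> d" and s: "2 ^ k * j \<le> (2 ^ d :: nat)"
  shows "lambda d (2 ^ k * j) \<ge> c_rank d k"
proof -
  let ?m = "d - k"
  let ?p = "Pi_pmf {..<d} (0\<^sub>v ?m) (\<lambda>_. pmf_of_set (carrier_vec ?m :: bit vec set))"
  have "2 ^ k * j \<le> 2 ^ k * 2 ^ ?m" using k s by (simp flip: power_add)
  then have j: "j \<le> 2 ^ ?m" by simp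
  have M: "mat_of_cols ?m (map r [0..<d]) \<in> carrier_mat ?m d" for r :: "nat \<Rightarrow> bit vec"
    by (auto intro: carrier_matI)
  have "{r :: nat \<Rightarrow> bit vec. vec_space.rank ?m (mat_of_cols ?m (map r [0..<d])) = ?m} \<subseteq>
      {r. onto_mat ?m d (mat_of_cols ?m (map r [0..<d]))}"
    using onto_mat_of_rank[OF M] by blast
  then have "c_rank d k \<le> measure_pmf.prob ?p {r. onto_mat ?m d (mat_of_cols ?m (map r [0..<d]))}"
    unfolding c_rank_def by (intro measure_pmf.finite_measure_mono) auto
  also have "\<dots> \<le> lambda d (2 ^ k * j)"
    using lambda_ge_prob_onto[of ?m d j] j k by simp
  finally show ?thesis .
qed

text \<open>This is the preimage of a single point under a map to dimension \<open>d - k\<close>,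
  where the failure bound \<open>2 ^ (d - k) / 2 ^ d\<close> is \<open>1 / 2 ^ k\<close>.\<close>

lemma lambda_power2_ge:
  assumes "2 ^ k \<le> (2 ^ d :: nat)"
  shows "lambda d (2 ^ k) \<ge> 1 - 1 / 2 ^ k"
proof -
  have k: "k \<le> d" using assms by simp
  have "1 - 1 / 2 ^ k = 1 - 2 ^ (d - k) / (2 ^ d :: real)"
    using k by (simp add: power_diff)
  also have "\<dots> \<le> measure_pmf.prob (Pi_pmf {..<d} (0\<^sub>v (d - k)) (\<lambda>_. pmf_of_set (carrier_vec (d - k) :: bit vec set)))
     {r. onto_mat (d - k) d (mat_of_cols (d - k) (map r [0..<d]))}"
    by (rule prob_onto_mat_ge)
  also have "\<dots> \<le> lambda d (2 ^ k)"
    using lambda_ge_prob_onto[of "d - k" d 1] k by simp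
  finally show ?thesis .
qed

theorem theorem2:
  shows "(\<forall>d::nat. d \<ge> 2 \<longrightarrow> lambda d 1 \<ge> (1 - 1 / 2 ^ d) ^ (2 ^ d - 1))
    \<and> (\<forall>(d::nat) (s::nat). d \<ge> 1 \<longrightarrow> s \<le> 2 ^ d \<longrightarrow> lambda d s \<ge> c_nonsing d)
    \<and> (\<forall>(d::nat) (s::nat) (k::nat) (j::nat). d \<ge> 1 \<longrightarrow> 0 < s \<longrightarrow> s \<le> 2 ^ (d - 1) \<longrightarrow>
         s = 2 ^ k * j \<longrightarrow> odd j \<longrightarrow> lambda d s \<ge> c_rank d k)
    \<and> (\<forall>(d::nat) (s::nat). d \<ge> 1 \<longrightarrow> s \<le> 2 ^ d \<longrightarrow> (\<exists>k::nat. s = 2 ^ k) \<longrightarrow>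
         lambda d s \<ge> 1 - 1 / real s)"
proof (intro conjI allI impI)
  fix d s k j :: nat
  assume s: "0 < s" "s \<le> 2 ^ (d - 1)" "s = 2 ^ k * j"
  have sd: "s \<le> 2 ^ d" using s(2) by (rule order.trans) (simp add: power_increasing)
  \<comment> \<open>Positivity of \<open>s\<close> gives \<open>j \<ge> 1\<close>, hence
    \<open>2 ^ k \<le> s\<close>.\<close>
  have "2 ^ k * 1 \<le> 2 ^ k * j" using s by (intro mult_le_mono) auto
  then have "(2 :: nat) ^ k \<le> 2 ^ d" using s(3) sd by linarith
  then have "k \<le> d" by simp
  then show "lambda d s \<ge> c_rank d k"
    using lambda_ge_c_rank[of k d j] s(3) sd by simp
next
  fix d s :: nat
  assume "s \<le> 2 ^ d" "\<exists>k. s = 2 ^ k"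
  then show "lambda d s \<ge> 1 - 1 / real s"
    using lambda_power2_ge by auto
qed (use lambda_ge_random_subset lambda_ge_c_nonsing in auto)

end
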